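(* Let $A$ be an ordered alphabet and let $F=F_0\cup\dots\cup F_{k-1}$ ($k\ge 1$) be a finite union of final segments of $A^{\ast}$ such that for each $i<k$, $F_i=\uparrow X_i$ is generated by the set $X_i$ of all words $a_0a_1\cdots a_{n_i-1}$ of length $n_i$ with $a_j\in X_{i,j}$ for all $j<n_i$, where $X_{i,0},\dots,X_{i,n_i-1}$ are non-empty subsets of $A$. Then, as a lattice, the injective envelope $\mathcal{S}_F$ can be identified with an intersection closed subset of $\mathbf{F}(\mathbf{n}_0\otimes\cdots\otimes\mathbf{n}_{k-1})$; that is, there is an order-embedding of $(\mathcal{S}_F,\subseteq)$ into $(\mathbf{F}(\mathbf{n}_0\otimes\cdots\otimes\mathbf{n}_{k-1}),\subseteq)$ whose image is closed under intersections. Moreover, if $\downarrow u_i\cap\downarrow u_j=\{\Box\}$ whenever $u_i\in X_i$, $u_j\in X_j$ and $i\ne j$, then $\mathcal{S}_F$ identifies with the full set, i.e. $(\mathcal{S}_F,\subseteq)$ is isomorphic to $(\mathbf{F}(\mathbf{n}_0\otimes\cdots\otimes\mathbf{n}_{k-1}),\subseteq)$.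
   Context: $A$ is a partially ordered set. $A^{\ast}$ is the free monoid of words over $A$ with empty word $\Box$, ordered by the Higman ordering: $a_0\cdots a_{n-1}\le b_0\cdots b_{m-1}$ iff there is a strictly increasing map $h:\{0,\dots,n-1\}\to\{0,\dots,m-1\}$ with $a_i\le b_{h(i)}$ for all $i$. A final segment is an upward closed subset. $\uparrow X$ is the final segment generated by $X$, and $\downarrow u=\{v\in A^{\ast}:v\le u\}$. For $Y\subseteq A^{\ast}$, $FY^{-1}:=\{u\in A^{\ast}:uy\in F\text{ for all }y\in Y\}$, and $\mathcal{S}_F:=\{FY^{-1}:Y\subseteq A^{\ast}\}$, ordered by inclusion (a complete lattice whose meet is intersection and whose largest element is $A^{\ast}$; with a suitable distance it represents the injective envelope of a two-element metric space $\{x,y\}$ with $d(x,y)=F$). $\mathbf{n}_i:=\{0,\dots,n_i-1\}$ with the natural order, $\mathbf{n}_0\otimes\cdots\otimes\mathbf{n}_{k-1}$ is the direct product of these chains with the product order, and for a poset $P$, $\mathbf{F}(P)$ is the set of all final segments of $P$ (including $\emptyset$ and $P$) ordered by inclusion. *)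

theory Defs
  imports "HOL-Library.FuncSet" "HOL-Library.Sublist"
begin

text \<open>
  The ordered alphabet is a subset \<open>A\<close> of a type of class \<^class>\<open>order\<close>, so that the
  empty alphabet is covered as well; the free monoid over it is \<open>lists A\<close>.
\<close>

definition higman_le :: "'a::order list \<Rightarrow> 'a list \<Rightarrow> bool" where
  "higman_le u v \<longleftrightarrow>
    (\<exists>h. strict_mono_on {..<length u} h \<and> h ` {..<length u} \<subseteq> {..<length v} \<and>
         (\<forall>i<length u. u ! i \<le> v ! h i))"

lemma higman_le_iff_list_emb: "higman_le u v \<longleftrightarrow> list_emb (\<le>) u v"
proof
  assume "list_emb (\<le>) u v"
  then show "higman_le u v"
  proof induction
    case (list_emb_Nil ys)
    show ?case by (auto simp: higman_le_def strict_mono_on_def)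
  next
    case (list_emb_Cons xs ys y)
    then obtain h where h: "strict_mono_on {..<length xs} h"
      "h ` {..<length xs} \<subseteq> {..<length ys}" "\<forall>i<length xs. xs ! i \<le> ys ! h i"
      by (auto simp: higman_le_def)
    then have "strict_mono_on {..<length xs} (\<lambda>i. Suc (h i))"
      by (auto simp: strict_mono_on_def)
    with h show ?case
      unfolding higman_le_def by (intro exI[of _ "\<lambda>i. Suc (h i)"]) auto
  next
    case (list_emb_Cons2 x y xs ys)
    then obtain h where h: "strict_mono_on {..<length xs} h"
      "h ` {..<length xs} \<subseteq> {..<length ys}" "\<forall>i<length xs. xs ! i \<le> ys ! h i"
      by (auto simp: higman_le_def)
    let ?h = "\<lambda>i. case i of 0 \<Rightarrow> 0 | Suc j \<Rightarrow> Suc (h j)"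
    have "strict_mono_on {..<length (x # xs)} ?h"
      using h(1) by (auto simp: strict_mono_on_def split: nat.splits)
    moreover have "?h ` {..<length (x # xs)} \<subseteq> {..<length (y # ys)}"
      using h(2) by (auto simp: image_subset_iff split: nat.splits)
    moreover have "\<forall>i<length (x # xs). (x # xs) ! i \<le> (y # ys) ! ?h i"
      using h(3) list_emb_Cons2(1) by (auto split: nat.splits)
    ultimately show ?case
      unfolding higman_le_def by blast
  qed
next
  assume "higman_le u v"
  then show "list_emb (\<le>) u v"
  proof (induction v arbitrary: u)
    case Nil
    then show ?case by (cases u) (auto simp: higman_le_def)
  next
    case (Cons y ys)
    then obtain h where h: "strict_mono_on {..<length u} h"
      "h ` {..<length u} \<subseteq> {..<length (y # ys)}" "\<forall>i<length u. u ! i \<le> (y # ys) ! h i"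
      unfolding higman_le_def by blast
    show ?case
    proof (cases u)
      case u: (Cons x xs)
      have less: "h i < h j" if "i < j" "j \<le> length xs" for i j
        using h(1) that u by (auto simp: strict_mono_on_def)
      have bd: "h i < Suc (length ys)" if "i \<le> length xs" for i
        using h(2) that u by (auto simp: subset_iff)
      have le: "(x # xs) ! i \<le> (y # ys) ! h i" if "i \<le> length xs" for i
        using h(3) that u by auto
      have pos: "0 < h (Suc i)" if "i < length xs" for i
        using less[of i "Suc i"] that by simp
      have tail: "higman_le xs ys"
        unfolding higman_le_def
      proof (intro exI conjI)
        show "strict_mono_on {..<length xs} (\<lambda>i. h (Suc i) - 1)"
          using less pos by (auto simp: strict_mono_on_def intro!: diff_less_mono Suc_leI)
        show "(\<lambda>i. h (Suc i) - 1) ` {..<length xs} \<subseteq> {..<length ys}"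
          using bd pos by (fastforce simp: less_diff_conv2)
        show "\<forall>i<length xs. xs ! i \<le> ys ! (h (Suc i) - 1)"
        proof (intro allI impI)
          fix i assume "i < length xs"
          then show "xs ! i \<le> ys ! (h (Suc i) - 1)"
            using le[of "Suc i"] pos[of i] by (simp add: nth_Cons')
        qed
      qed
      show ?thesis
      proof (cases "h 0 = 0")
        case True
        with le[of 0] have "x \<le> y" by simp
        with Cons.IH[OF tail] u show ?thesis by auto
      next
        case False
        have pos': "0 < h i" if "i \<le> length xs" for i
          using False less[of 0 i] that by (cases i) auto
        have "higman_le u ys"
          unfolding higman_le_def
        proof (intro exI conjI)
          show "strict_mono_on {..<length u} (\<lambda>i. h i - 1)"
            using less pos' u by (auto simp: strict_mono_on_def less_Suc_eq_le intro!: diff_less_mono Suc_leI)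
          show "(\<lambda>i. h i - 1) ` {..<length u} \<subseteq> {..<length ys}"
            using bd pos' u by (fastforce simp: less_diff_conv2 less_Suc_eq_le)
          show "\<forall>i<length u. u ! i \<le> ys ! (h i - 1)"
          proof (intro allI impI)
            fix i assume "i < length u"
            then show "u ! i \<le> ys ! (h i - 1)"
              using le[of i] pos'[of i] u by (simp add: nth_Cons'[of y] less_Suc_eq_le)
          qed
        qed
        then show ?thesis using Cons.IH by auto
      qed
    qed auto
  qed
qed

definition word_up :: "'a::order set \<Rightarrow> 'a list set \<Rightarrow> 'a list set" where
  "word_up A W = {v \<in> lists A. \<exists>u\<in>W. higman_le u v}"

definition word_down :: "'a::order set \<Rightarrow> 'a list \<Rightarrow> 'a list set" where
  "word_down A u = {v \<in> lists A. higman_le v u}"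

definition box_words :: "nat \<Rightarrow> (nat \<Rightarrow> 'a set) \<Rightarrow> 'a list set" where
  "box_words m Z = {w. length w = m \<and> (\<forall>j<m. w ! j \<in> Z j)}"

definition residual :: "'a set \<Rightarrow> 'a list set \<Rightarrow> 'a list set \<Rightarrow> 'a list set" where
  "residual A F Y = {u \<in> lists A. \<forall>y\<in>Y. u @ y \<in> F}"

text \<open>
  The set of all residuals, ordered by inclusion, represents the injective envelope of the
  two-element metric space over final segments whose two points are at distance \<open>F\<close>.
\<close>

definition envelope :: "'a set \<Rightarrow> 'a list set \<Rightarrow> 'a list set set" where
  "envelope A F = {residual A F Y | Y. Y \<subseteq> lists A}"

text \<open>
  Elements of the product are extensional functions. Outside \<open>{..<k}\<close> they all take the
  value \<^const>\<open>undefined\<close>, so the pointwise order on \<^typ>\<open>nat \<Rightarrow> nat\<close> restricts to the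
  product order.
\<close>

definition chain_product :: "nat \<Rightarrow> (nat \<Rightarrow> nat) \<Rightarrow> (nat \<Rightarrow> nat) set" where
  "chain_product k n = (\<Pi>\<^sub>E i\<in>{..<k}. {..<n i})"

definition final_segments :: "'b::order set \<Rightarrow> 'b set set" where
  "final_segments P = {S. S \<subseteq> P \<and> (\<forall>x\<in>S. \<forall>y\<in>P. x \<le> y \<longrightarrow> y \<in> S)}"

definition incl_embedding :: "('a set \<Rightarrow> 'b set) \<Rightarrow> 'a set set \<Rightarrow> 'b set set \<Rightarrow> bool" where
  "incl_embedding f L M \<longleftrightarrow> f ` L \<subseteq> M \<and> (\<forall>S\<in>L. \<forall>T\<in>L. f S \<subseteq> f T \<longleftrightarrow> S \<subseteq> T)"

definition incl_isomorphism :: "('a set \<Rightarrow> 'b set) \<Rightarrow> 'a set set \<Rightarrow> 'b set set \<Rightarrow> bool" where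
  "incl_isomorphism f L M \<longleftrightarrow> bij_betw f L M \<and> (\<forall>S\<in>L. \<forall>T\<in>L. f S \<subseteq> f T \<longleftrightarrow> S \<subseteq> T)"

text \<open>
  Arbitrary intersections of subsets of \<open>P\<close>; the empty intersection is \<open>P\<close> itself, which is
  why \<open>P\<close> is a parameter (\<open>\<Inter>{}\<close> would be \<^const>\<open>UNIV\<close>).
\<close>

definition inter_closed :: "'b set \<Rightarrow> 'b set set \<Rightarrow> bool" where
  "inter_closed P C \<longleftrightarrow> (\<forall>G\<subseteq>C. P \<inter> \<Inter>G \<in> C)"

end

(*
  For each i let p_i(u) be the number of blocks X_{i,0}, X_{i,1}, ... that the word u passes
  through greedily.  Then u y lies in F_i iff y can finish the blocks from p_i(u) on, so membership
  of u in a residual depends only, and monotonically, on the tuple p(u); and u lies in F as soon as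
  p(u) leaves the product of the chains.  Sending a residual R to the largest final segment S such
  that p(u) in S implies u in R therefore is an order embedding, and it commutes with
  intersections.

  Under the disjointness hypothesis, letters of different blocks i do not interfere, so that
  concatenating one word for each i realises every tuple both as some p(u) and as a "deficit" of
  some y; every final segment of the product is then in the image.
*)
theory Submission
  imports Defs
begin

section \<open>Matching a list of positions into a word\<close>

text \<open>
  \<^const>\<open>list_emb\<close> relates lists over one type only; here positions are matched with letters.
\<close>

definition matches :: "('b \<Rightarrow> 'a \<Rightarrow> bool) \<Rightarrow> 'b list \<Rightarrow> 'a list \<Rightarrow> bool" where
  "matches P xs v \<longleftrightarrow> (\<exists>w. subseq w v \<and> list_all2 P xs w)"

lemma matches_Nil [simp]: "matches P [] v"
  by (auto simp: matches_def)

lemma matchesI: "subseq w v \<Longrightarrow> list_all2 P xs w \<Longrightarrow> matches P xs v"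
  unfolding matches_def by blast

lemma matchesE:
  assumes "matches P xs v"
  obtains w where "subseq w v" "list_all2 P xs w"
  using assms unfolding matches_def by blast

lemma matches_subseq:
  assumes "matches P xs v" "subseq v v'"
  shows "matches P xs v'"
  using assms(1) by (rule matchesE) (rule matchesI[OF subseq_order.order_trans[OF _ assms(2)]])

text \<open>The index set that selects \<open>xs'\<close> from \<open>xs\<close> also selects, from
  the word matched with \<open>xs\<close>, a word matched with \<open>xs'\<close>.\<close>

lemma matches_subseq_left:
  assumes "matches P xs v" "subseq xs' xs"
  shows "matches P xs' v"
proof -
  obtain w where w: "subseq w v" "list_all2 P xs w" using assms(1) by (rule matchesE)
  from assms(2) obtain N where N: "xs' = nths xs N" unfolding subseq_conv_nths by (rule exE)
  have "list_all2 P (nths xs N) (nths w N)"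
    using w(2) by (induction arbitrary: N) (auto simp: nths_Cons)
  moreover have "subseq (nths w N) v"
    by (rule subseq_order.order_trans[OF _ w(1)]) (auto simp: subseq_conv_nths)
  ultimately show ?thesis unfolding N by (intro matchesI)
qed

lemma matches_length: "matches P xs v \<Longrightarrow> length xs \<le> length v"
  by (erule matchesE) (drule list_emb_length, drule list_all2_lengthD, simp)

lemma matches_append_right_iff:
  "matches P xs (us @ vs) \<longleftrightarrow> (\<exists>ys zs. xs = ys @ zs \<and> matches P ys us \<and> matches P zs vs)"
proof
  assume "matches P xs (us @ vs)"
  then obtain w1 w2 where w: "subseq w1 us" "subseq w2 vs" "list_all2 P xs (w1 @ w2)"
    by (elim matchesE subseq_appendE) simp
  then show "\<exists>ys zs. xs = ys @ zs \<and> matches P ys us \<and> matches P zs vs"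
    by (auto simp: list_all2_append2 intro: matchesI)
next
  assume "\<exists>ys zs. xs = ys @ zs \<and> matches P ys us \<and> matches P zs vs"
  then show "matches P xs (us @ vs)"
    by (auto elim!: matchesE intro: matchesI list_all2_appendI list_emb_append_mono)
qed

lemma matches_eq_Nil:
  assumes "matches P xs ys" and "\<And>x y. x \<in> set xs \<Longrightarrow> y \<in> set ys \<Longrightarrow> \<not> P x y"
  shows "xs = []"
proof (cases xs)
  case (Cons x xs')
  with assms(1) obtain a w where "subseq (a # w) ys" "P x a"
    by (auto simp: matches_def list_all2_Cons1)
  then have "a \<in> set ys" using list_emb_set[of "(=)" "a # w" ys a] by auto
  with assms(2) Cons \<open>P x a\<close> show ?thesis by auto
qed simp

text \<open>The pieces of \<open>xs\<close> that fall into \<open>us\<close> and \<open>vs\<close>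
  must be empty. This isolates the part of a long concatenation that is relevant to a single
  box.\<close>

lemma matches_middle:
  assumes "matches P xs (us @ ws @ vs)"
    and "\<And>x y. x \<in> set xs \<Longrightarrow> y \<in> set us \<union> set vs \<Longrightarrow> \<not> P x y"
  shows "matches P xs ws"
proof -
  from assms(1) obtain as bs cs where xs: "xs = as @ bs @ cs"
    and *: "matches P as us" "matches P bs ws" "matches P cs vs"
    unfolding matches_append_right_iff by blast
  have "as = []" using *(1) by (rule matches_eq_Nil) (use assms(2) xs in auto)
  moreover have "cs = []" using *(3) by (rule matches_eq_Nil) (use assms(2) xs in auto)
  ultimately show ?thesis using xs * by simp
qed

lemma list_emb_iff_matches: "list_emb R w v \<longleftrightarrow> matches R w v"
proof
  assume "list_emb R w v"
  then show "matches R w v"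
  proof induction
    case (list_emb_Cons xs ys y)
    then show ?case by (auto elim: matches_subseq)
  next
    case (list_emb_Cons2 x y xs ys)
    then obtain w where "subseq w ys" "list_all2 R xs w" by (auto simp: matches_def)
    with list_emb_Cons2 have "subseq (y # w) (y # ys)" "list_all2 R (x # xs) (y # w)" by auto
    then show ?case unfolding matches_def by blast
  qed simp
next
  assume "matches R w v"
  then obtain v' where "subseq v' v" "list_all2 R w v'" by (auto simp: matches_def)
  then show "list_emb R w v"
    by (induction arbitrary: w) (auto simp: list_all2_Cons2)
qed

lemma matches_comp_iff:
  "matches (Q OO R) xs v \<longleftrightarrow> (\<exists>w. list_all2 Q xs w \<and> matches R w v)"
  by (auto simp: matches_def list.rel_compp relcompp_apply)

section \<open>Words above a box and greedy progress\<close>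

definition block_le :: "(nat \<Rightarrow> 'a::order set) \<Rightarrow> nat \<Rightarrow> 'a \<Rightarrow> bool" where
  "block_le Z j a \<longleftrightarrow> (\<exists>z\<in>Z j. z \<le> a)"

text \<open>A box word chooses its letters independently at each position, so choosing a generator
  and embedding it into \<open>v\<close> collapses into one matching, by the composite of membership
  and \<open>(\<le>)\<close>.\<close>

lemma word_up_box_words:
  "v \<in> word_up A (box_words m Z) \<longleftrightarrow> v \<in> lists A \<and> matches (block_le Z) [0..<m] v"
proof -
  have "w \<in> box_words m Z \<longleftrightarrow> list_all2 (\<lambda>j z. z \<in> Z j) [0..<m] w" for w
    by (auto simp: box_words_def list_all2_conv_all_nth)
  then have "(\<exists>w\<in>box_words m Z. higman_le w v)
      \<longleftrightarrow> matches ((\<lambda>j z. z \<in> Z j) OO (\<le>)) [0..<m] v"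
    by (simp add: higman_le_iff_list_emb list_emb_iff_matches matches_comp_iff) blast
  moreover have "block_le Z = (\<lambda>j z. z \<in> Z j) OO (\<le>)"
    by (auto simp: block_le_def fun_eq_iff)
  ultimately show ?thesis by (simp add: word_up_def)
qed

text \<open>
  The number of blocks is not a parameter: the value may exceed it, through the arbitrary sets
  \<open>Z j\<close> beyond the last block.
\<close>

definition progress :: "(nat \<Rightarrow> 'a::order set) \<Rightarrow> 'a list \<Rightarrow> nat" where
  "progress Z u = (GREATEST m. matches (block_le Z) [0..<m] u)"

lemma matches_upt_mono:
  assumes "matches P [i..<j] u" "i \<le> i'" "j' \<le> j"
  shows "matches P [i'..<j'] u"
proof (cases "i' \<le> j'")
  case True
  have "[i..<j] = [i..<i'] @ [i'..<j'] @ [j'..<j]"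
    using assms True by (metis le_Suc_ex le_trans upt_add_eq_append)
  then have "subseq [i'..<j'] [i..<j]" by (simp add: list_emb_append2 list_emb_prefix)
  with assms(1) show ?thesis by (rule matches_subseq_left)
qed simp

text \<open>The admissible \<open>m\<close> contain 0, are closed downward, and are bounded by
  \<open>length u\<close> because each position uses up its own letter; so the greatest one
  determines them all.\<close>

lemma le_progress_iff: "m \<le> progress Z u \<longleftrightarrow> matches (block_le Z) [0..<m] u"
proof -
  have bound: "l \<le> length u" if "matches (block_le Z) [0..<l] u" for l
    using matches_length[OF that] by simp
  have "matches (block_le Z) [0..<progress Z u] u"
    unfolding progress_def
    by (rule GreatestI_nat[where k = 0 and b = "length u"]) (use bound in auto)
  moreover have "m \<le> progress Z u" if "matches (block_le Z) [0..<m] u"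
    unfolding progress_def
    by (rule Greatest_le_nat[where b = "length u"]) (use bound that in auto)
  moreover have "matches (block_le Z) [0..<m] u"
    if "matches (block_le Z) [0..<progress Z u] u" "m \<le> progress Z u"
    using that by (rule matches_upt_mono[OF _ le_refl])
  ultimately show ?thesis by blast
qed

text \<open>A matching splits at some \<open>l\<close> with \<open>[0..<l]\<close> matched in
  \<open>u\<close>. Then \<open>l\<close> is at most the progress of \<open>u\<close>, so letting
  \<open>u\<close> take as many blocks as it can never hurts \<open>y\<close>.\<close>

lemma append_box_iff:
  "matches (block_le Z) [0..<m] (u @ y) \<longleftrightarrow> matches (block_le Z) [progress Z u..<m] y"
proof
  assume "matches (block_le Z) [0..<m] (u @ y)"
  then obtain as bs where ab: "[0..<m] = as @ bs" "matches (block_le Z) as u"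
    "matches (block_le Z) bs y"
    unfolding matches_append_right_iff by blast
  define l where "l = length as"
  have "length as \<le> m" using ab(1) by (metis length_append length_upt le_add1 diff_zero)
  with ab(1) have "as = [0..<l]" "bs = [l..<m]"
    by (metis append_eq_conv_conj l_def take_upt add_0, 
        metis append_eq_conv_conj l_def drop_upt add_0)
  with ab show "matches (block_le Z) [progress Z u..<m] y"
    by (auto intro: matches_upt_mono simp: le_progress_iff)
next
  let ?p = "progress Z u"
  assume y: "matches (block_le Z) [?p..<m] y"
  have u: "matches (block_le Z) [0..<?p] u" using le_progress_iff by blast
  show "matches (block_le Z) [0..<m] (u @ y)"
  proof (cases "?p \<le> m")
    case True
    then have "[0..<m] = [0..<?p] @ [?p..<m]"
      by (metis le_add_diff_inverse upt_add_eq_append le0)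
    with u y show ?thesis by (auto simp: matches_append_right_iff)
  next
    \<comment> \<open>The progress may exceed \<open>m\<close>; then nothing is left for
      \<open>y\<close> and \<open>u\<close> alone suffices.\<close>
    case False
    then have "matches (block_le Z) [0..<m] u" by (simp flip: le_progress_iff)
    then show ?thesis by (rule matches_subseq) (simp add: list_emb_prefix)
  qed
qed

section \<open>The order embedding of the envelope\<close>

locale box_union =
  fixes A :: "'a::order set"
    and k :: nat
    and n :: "nat \<Rightarrow> nat"
    and X :: "nat \<Rightarrow> nat \<Rightarrow> 'a set"
  assumes X_subset: "\<And>i j. i < k \<Longrightarrow> j < n i \<Longrightarrow> X i j \<subseteq> A"
    and X_nonempty: "\<And>i j. i < k \<Longrightarrow> j < n i \<Longrightarrow> X i j \<noteq> {}"
begin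

definition F :: "'a list set" where
  "F = (\<Union>i<k. word_up A (box_words (n i) (X i)))"

text \<open>Quantifying over all \<open>u\<close> whose progress dominates \<open>x\<close>, inside
  the product or not, makes the value a final segment for every \<open>R\<close> and makes the map
  commute with intersections.\<close>

definition env_map :: "'a list set \<Rightarrow> (nat \<Rightarrow> nat) set" where
  "env_map R =
    {x \<in> chain_product k n. \<forall>u\<in>lists A. (\<forall>i<k. x i \<le> progress (X i) u) \<longrightarrow> u \<in> R}"

lemma append_in_F_iff:
  assumes "u \<in> lists A" "y \<in> lists A"
  shows "u @ y \<in> F \<longleftrightarrow> (\<exists>i<k. matches (block_le (X i)) [progress (X i) u..<n i] y)"
  using assms by (auto simp: F_def word_up_box_words append_box_iff)

text \<open>More progress leaves fewer blocks for the right factor \<open>y\<close> to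
  finish.\<close>

lemma residual_mono_progress:
  assumes "u \<in> residual A F Y" "Y \<subseteq> lists A" "v \<in> lists A"
    and "\<And>i. i < k \<Longrightarrow> progress (X i) u \<le> progress (X i) v"
  shows "v \<in> residual A F Y"
  unfolding residual_def
proof (intro CollectI conjI ballI)
  fix y assume y: "y \<in> Y"
  then have "u @ y \<in> F" "u \<in> lists A" "y \<in> lists A" using assms(1,2) by (auto simp: residual_def)
  then obtain i where "i < k" "matches (block_le (X i)) [progress (X i) u..<n i] y"
    using append_in_F_iff by blast
  with assms(4) have "matches (block_le (X i)) [progress (X i) v..<n i] y"
    by (auto intro: matches_upt_mono)
  then show "v @ y \<in> F" using \<open>i < k\<close> \<open>y \<in> lists A\<close> assms(3) append_in_F_iff by blast
qed (use assms(3) in simp)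

text \<open>No block of box \<open>i\<close> is left over. Hence words whose progress leaves the
  product lie in every residual and need no point to represent them.\<close>

lemma progress_complete_in_residual:
  assumes "Y \<subseteq> lists A" "u \<in> lists A" "i < k" "n i \<le> progress (X i) u"
  shows "u \<in> residual A F Y"
proof -
  have "matches (block_le (X i)) [progress (X i) u..<n i] y" for y
    using assms(4) by simp
  then show ?thesis
    using assms append_in_F_iff by (auto simp: residual_def subset_iff)
qed

lemma progress_in_chain_product:
  assumes "\<And>i. i < k \<Longrightarrow> progress (X i) u < n i"
  shows "(\<lambda>i\<in>{..<k}. progress (X i) u) \<in> chain_product k n"
  using assms by (simp add: chain_product_def)

lemma env_map_le_iff:
  assumes "R \<in> envelope A F" "R' \<in> envelope A F"
  shows "env_map R \<subseteq> env_map R' \<longleftrightarrow> R \<subseteq> R'"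
proof
  assume sub: "env_map R \<subseteq> env_map R'"
  obtain Y Y' where Y: "R = residual A F Y" "Y \<subseteq> lists A"
    and Y': "R' = residual A F Y'" "Y' \<subseteq> lists A"
    using assms by (auto simp: envelope_def)
  show "R \<subseteq> R'"
  proof
    fix u assume u: "u \<in> R"
    then have uA: "u \<in> lists A" using Y by (simp add: residual_def)
    show "u \<in> R'"
    proof (cases "\<exists>i<k. n i \<le> progress (X i) u")
      case True
      then show ?thesis using progress_complete_in_residual uA Y' by blast
    next
      case False
      let ?x = "\<lambda>i\<in>{..<k}. progress (X i) u"
      have "?x \<in> chain_product k n"
        by (rule progress_in_chain_product) (use False in \<open>auto simp: not_le\<close>)
      \<comment> \<open>Monotonicity puts the progress tuple of \<open>u\<close> into
        \<open>env_map R\<close>; once it is in \<open>env_map R'\<close>, the defining condition is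
        applied to \<open>u\<close> itself.\<close>
      then have "?x \<in> env_map R"
        using residual_mono_progress[of u Y] u Y by (simp add: env_map_def)
      then have "?x \<in> env_map R'" using sub by blast
      then show ?thesis using uA by (simp add: env_map_def)
    qed
  qed
qed (auto simp: env_map_def)

lemma env_map_embedding:
  "incl_embedding env_map (envelope A F) (final_segments (chain_product k n))"
proof -
  have "env_map R \<in> final_segments (chain_product k n)" for R
  proof -
    have "y \<in> env_map R" if "x \<in> env_map R" "y \<in> chain_product k n" "x \<le> y" for x y
      using that order_trans[OF le_funD[OF that(3)]] by (simp add: env_map_def)
    then show ?thesis by (auto simp: final_segments_def env_map_def)
  qed
  then show ?thesis
    using env_map_le_iff by (auto simp: incl_embedding_def)
qed

lemma env_map_inter_closed:
  "inter_closed (chain_product k n) (env_map ` envelope A F)"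
  unfolding inter_closed_def
proof (intro allI impI)
  fix G assume "G \<subseteq> env_map ` envelope A F"
  then obtain E where E: "E \<subseteq> envelope A F" and G: "G = env_map ` E"
    by (meson subset_imageE)
  \<comment> \<open>The union of all sets that represent members of \<open>E\<close>: a residual of
    a union is the intersection of the residuals. The factor \<open>lists A\<close> below covers the
    case of empty \<open>E\<close>.\<close>
  define Y where "Y = \<Union>{Y. Y \<subseteq> lists A \<and> residual A F Y \<in> E}"
  have Y: "residual A F Y = lists A \<inter> \<Inter>E"
  proof (intro equalityI subsetI)
    fix u assume u: "u \<in> residual A F Y"
    have "u \<in> R" if "R \<in> E" for R
    proof -
      from that E obtain Z where "R = residual A F Z" "Z \<subseteq> lists A"
        by (auto simp: envelope_def)
      with u that show ?thesis by (auto simp: residual_def Y_def)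
    qed
    with u show "u \<in> lists A \<inter> \<Inter>E" by (auto simp: residual_def)
  next
    fix u assume "u \<in> lists A \<inter> \<Inter>E"
    then show "u \<in> residual A F Y" by (auto simp: residual_def Y_def)
  qed
  have "residual A F Y \<in> envelope A F"
    by (auto simp: envelope_def Y_def)
  moreover have "chain_product k n \<inter> \<Inter>G = env_map (residual A F Y)"
    unfolding G Y env_map_def by blast
  ultimately show "chain_product k n \<inter> \<Inter>G \<in> env_map ` envelope A F" by blast
qed

section \<open>Surjectivity for separated boxes\<close>

definition separated :: bool where
  "separated \<longleftrightarrow> (\<forall>i<k. \<forall>j<k. i \<noteq> j \<longrightarrow>
     (\<forall>u\<in>box_words (n i) (X i). \<forall>v\<in>box_words (n j) (X j).
        word_down A u \<inter> word_down A v = {[]}))"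

lemma ex_box_word:
  assumes "i < k" "j < n i" "z \<in> X i j"
  shows "\<exists>w\<in>box_words (n i) (X i). z \<in> set w"
proof
  let ?w = "map (\<lambda>l. if l = j then z else SOME a. a \<in> X i l) [0..<n i]"
  show "?w \<in> box_words (n i) (X i)"
    using assms X_nonempty by (auto simp: box_words_def some_in_eq)
  show "z \<in> set ?w" using assms by force
qed

text \<open>Otherwise the one-letter word \<open>[z]\<close> would lie below box words of both
  \<open>i\<close> and \<open>j\<close>.\<close>

lemma separated_not_le:
  assumes separated "i < k" "j < k" "i \<noteq> j" "a < n i" "b < n j" "z \<in> X i a" "w \<in> X j b"
  shows "\<not> z \<le> w"
proof
  assume "z \<le> w"
  obtain u v where u: "u \<in> box_words (n i) (X i)" "z \<in> set u"
    and v: "v \<in> box_words (n j) (X j)" "w \<in> set v"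
    using ex_box_word assms by metis
  have emb: "list_emb (\<le>) [z] l" if "c \<in> set l" "z \<le> c" for l c
    using that by (induction l) auto
  have "z \<in> A" using X_subset assms by blast
  then have "[z] \<in> word_down A u \<inter> word_down A v"
    using emb u v \<open>z \<le> w\<close> by (auto simp: word_down_def higman_le_iff_list_emb)
  moreover have "word_down A u \<inter> word_down A v = {[]}"
    using assms u v by (auto simp: separated_def)
  ultimately show False by auto
qed

text \<open>Concatenate, over all \<open>i\<close>, chosen letters along \<open>J i\<close>. By
  separation only the \<open>i\<close>-th factor can serve box \<open>i\<close>, and its length
  bounds every \<open>L\<close>. Initial intervals for \<open>J\<close> yield prescribed progress,
  final intervals prescribed deficits.\<close>

lemma ex_realising_word:
  assumes separated and J: "\<And>i. i < k \<Longrightarrow> set (J i) \<subseteq> {..<n i}"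
  obtains c where "c \<in> lists A"
    and "\<And>i. i < k \<Longrightarrow> matches (block_le (X i)) (J i) c"
    and "\<And>i L. i < k \<Longrightarrow> set L \<subseteq> {..<n i} \<Longrightarrow> matches (block_le (X i)) L c
           \<Longrightarrow> length L \<le> length (J i)"
proof
  define z where "z i j = (SOME a. a \<in> X i j)" for i j
  have z: "z i j \<in> X i j" if "i < k" "j < n i" for i j
    using X_nonempty[OF that] by (simp add: z_def some_in_eq)
  define w where "w i = map (z i) (J i)" for i
  define c where "c = concat (map w [0..<k])"
  have w_set: "\<exists>j<n i. a = z i j" if "i < k" "a \<in> set (w i)" for i a
    using that J by (auto simp: w_def)
  have "w i \<in> lists A" if "i < k" for i
    using w_set[OF that] z X_subset that by blast
  then show "c \<in> lists A" by (fastforce simp: c_def)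
  fix i assume i: "i < k"
  define us where "us = concat (map w [0..<i])"
  define vs where "vs = concat (map w [Suc i..<k])"
  have "[0..<k] = [0..<i] @ i # [Suc i..<k]"
    using i by (metis less_imp_add_positive less_imp_le upt_add_eq_append upt_conv_Cons le0)
  then have c: "c = us @ w i @ vs"
    by (simp add: c_def us_def vs_def)
  have "list_all2 (block_le (X i)) (J i) (w i)"
    using J[OF i] z i by (fastforce simp: w_def list.rel_map block_le_def intro: list.rel_refl_strong)
  then have "matches (block_le (X i)) (J i) (w i)"
    by (auto simp: matches_def)
  then show "matches (block_le (X i)) (J i) c"
    by (rule matches_subseq) (simp add: c list_emb_append2 list_emb_prefix)
  fix L assume L: "set L \<subseteq> {..<n i}" "matches (block_le (X i)) L c"
  have "matches (block_le (X i)) L (w i)"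
  proof (rule matches_middle)
    show "matches (block_le (X i)) L (us @ w i @ vs)" using L c by simp
    fix l a assume "l \<in> set L" and a: "a \<in> set us \<union> set vs"
    then have l: "l < n i" using L by blast
    from a have "\<exists>i'\<in>{..<i} \<union> {Suc i..<k}. a \<in> set (w i')"
      by (auto simp: us_def vs_def)
    then obtain i' where "i' \<in> {..<i} \<union> {Suc i..<k}" "a \<in> set (w i')" by (rule bexE)
    with i have i': "i' < k" "i' \<noteq> i" "a \<in> set (w i')" by auto
    with w_set obtain j where "j < n i'" "a = z i' j" by blast
    then show "\<not> block_le (X i) l a"
      using separated_not_le[OF assms(1) i i'(1)] i' l z by (auto simp: block_le_def)
  qed
  then show "length L \<le> length (J i)"
    using matches_length by (fastforce simp: w_def)
qed

lemma separated_ex_progress: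
  assumes separated "x \<in> chain_product k n"
  obtains u where "u \<in> lists A" "\<And>i. i < k \<Longrightarrow> progress (X i) u = x i"
proof -
  have x: "x i < n i" if "i < k" for i using assms(2) that by (auto simp: chain_product_def)
  then have "set [0..<x i] \<subseteq> {..<n i}" if "i < k" for i using that by fastforce
  then obtain u where u: "u \<in> lists A"
    "\<And>i. i < k \<Longrightarrow> matches (block_le (X i)) [0..<x i] u"
    "\<And>i L. i < k \<Longrightarrow> set L \<subseteq> {..<n i} \<Longrightarrow> matches (block_le (X i)) L u
       \<Longrightarrow> length L \<le> length [0..<x i]"
    using ex_realising_word[OF assms(1), of "\<lambda>i. [0..<x i]"] by blast
  have "progress (X i) u = x i" if i: "i < k" for i
  proof (rule antisym)
    show "x i \<le> progress (X i) u" using u(2) i by (simp add: le_progress_iff)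
    show "progress (X i) u \<le> x i"
    proof (rule ccontr)
      assume "\<not> ?thesis"
      \<comment> \<open>One block beyond \<open>x i\<close> is enough for a contradiction, and since
        \<open>x i < n i\<close> its index still lies in the range where separation applies.\<close>
      then have "matches (block_le (X i)) [0..<Suc (x i)] u"
        by (simp only: not_le Suc_le_eq flip: le_progress_iff)
      moreover have "set [0..<Suc (x i)] \<subseteq> {..<n i}" using x[OF i] by auto
      ultimately have "length [0..<Suc (x i)] \<le> length [0..<x i]" using u(3) i by blast
      then show False by simp
    qed
  qed
  with u(1) show ?thesis using that by blast
qed

text \<open>For such a \<open>y\<close>, \<open>u @ y \<in> F\<close> holds exactly when the
  progress of \<open>u\<close> exceeds \<open>x\<close> in some coordinate. So \<open>y\<close> cuts
  out the complement of the principal down-set of \<open>x\<close>.\<close>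

lemma separated_ex_deficit:
  assumes separated "x \<in> chain_product k n"
  obtains y where "y \<in> lists A"
    "\<And>i. i < k \<Longrightarrow> matches (block_le (X i)) [Suc (x i)..<n i] y"
    "\<And>i. i < k \<Longrightarrow> \<not> matches (block_le (X i)) [x i..<n i] y"
proof -
  have x: "x i < n i" if "i < k" for i using assms(2) that by (auto simp: chain_product_def)
  have "set [Suc (x i)..<n i] \<subseteq> {..<n i}" for i by auto
  then obtain y where y: "y \<in> lists A"
    "\<And>i. i < k \<Longrightarrow> matches (block_le (X i)) [Suc (x i)..<n i] y"
    "\<And>i L. i < k \<Longrightarrow> set L \<subseteq> {..<n i} \<Longrightarrow> matches (block_le (X i)) L y
       \<Longrightarrow> length L \<le> length [Suc (x i)..<n i]"
    using ex_realising_word[OF assms(1), of "\<lambda>i. [Suc (x i)..<n i]"] by blast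
  have "\<not> matches (block_le (X i)) [x i..<n i] y" if "i < k" for i
    using y(3)[OF that, of "[x i..<n i]"] x[OF that] by (auto simp: subset_iff)
  with y(1,2) show ?thesis using that by blast
qed

text \<open>A final segment is the intersection, over the points \<open>x\<close> outside it, of the
  complements of their principal down-sets; \<open>Y\<close> collects words that realise these
  complements.\<close>

lemma separated_env_map_surj:
  assumes separated and S: "S \<in> final_segments (chain_product k n)"
  shows "S \<in> env_map ` envelope A F"
proof -
  let ?P = "chain_product k n"
  define Y where "Y = {y \<in> lists A. \<exists>x\<in>?P - S. \<forall>i<k.
    matches (block_le (X i)) [Suc (x i)..<n i] y}"
  define R where "R = residual A F Y"
  have YA: "Y \<subseteq> lists A" by (auto simp: Y_def)
  have R_if: "u \<in> R"
    if u: "u \<in> lists A" and p: "\<And>x. x \<in> ?P - S \<Longrightarrow> \<exists>i<k. x i < progress (X i) u" for u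
    unfolding R_def residual_def
  proof (intro CollectI conjI ballI)
    fix y assume "y \<in> Y"
    then obtain x where y: "y \<in> lists A" and x: "x \<in> ?P - S"
      "\<And>i. i < k \<Longrightarrow> matches (block_le (X i)) [Suc (x i)..<n i] y"
      by (auto simp: Y_def)
    from p[OF x(1)] obtain i where "i < k" "x i < progress (X i) u" by blast
    then have "matches (block_le (X i)) [progress (X i) u..<n i] y"
      using matches_upt_mono[OF x(2)] by simp
    then show "u @ y \<in> F" using append_in_F_iff u y \<open>i < k\<close> by blast
  qed (use u in simp)
  have "env_map R = S"
  proof (intro equalityI subsetI)
    fix x assume x: "x \<in> env_map R"
    then have xP: "x \<in> ?P" by (simp add: env_map_def)
    \<comment> \<open>If \<open>x\<close> were outside \<open>S\<close>, its deficit word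
      \<open>y\<close> would belong to \<open>Y\<close>, while a word \<open>u\<close> of progress
      exactly \<open>x\<close> cannot be completed by \<open>y\<close>.\<close>
    obtain u where u: "u \<in> lists A" "\<And>i. i < k \<Longrightarrow> progress (X i) u = x i"
      using separated_ex_progress[OF assms(1) xP] by blast
    then have "u \<in> R" using x by (simp add: env_map_def)
    obtain y where y: "y \<in> lists A"
      "\<And>i. i < k \<Longrightarrow> matches (block_le (X i)) [Suc (x i)..<n i] y"
      "\<And>i. i < k \<Longrightarrow> \<not> matches (block_le (X i)) [x i..<n i] y"
      using separated_ex_deficit[OF assms(1) xP] by blast
    show "x \<in> S"
    proof (rule ccontr)
      assume "x \<notin> S"
      then have "y \<in> Y" using xP y by (auto simp: Y_def)
      then have "u @ y \<in> F" using \<open>u \<in> R\<close> by (simp add: R_def residual_def)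
      then show False using append_in_F_iff[OF u(1) y(1)] u(2) y(3) by auto
    qed
  next
    fix x assume x: "x \<in> S"
    then have xP: "x \<in> ?P" using S by (auto simp: final_segments_def)
    have "u \<in> R" if u: "u \<in> lists A" "\<forall>i<k. x i \<le> progress (X i) u" for u
    proof (rule R_if[OF u(1)])
      fix x' assume x': "x' \<in> ?P - S"
      show "\<exists>i<k. x' i < progress (X i) u"
      proof (rule ccontr)
        assume "\<not> ?thesis"
        \<comment> \<open>The progress of \<open>u\<close> would lie between \<open>x\<close> and
          \<open>x'\<close>, and then upward closure would put \<open>x'\<close> into
          \<open>S\<close>.\<close>
        with u(2) have "x i \<le> x' i" if "i < k" for i using that by (meson le_trans not_le)
        \<comment> \<open>Outside \<open>{..<k}\<close> both functions are \<open>undefined\<close>,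
          so the comparison extends to the pointwise order.\<close>
        moreover have "x i = x' i" if "\<not> i < k" for i
          using xP x' that by (auto simp: chain_product_def PiE_def extensional_def)
        ultimately have "x \<le> x'" by (metis le_fun_def order_refl)
        then show False using S x x' by (auto simp: final_segments_def)
      qed
    qed
    with xP show "x \<in> env_map R" by (simp add: env_map_def)
  qed
  moreover have "R \<in> envelope A F" using YA by (auto simp: R_def envelope_def)
  ultimately show ?thesis by blast
qed

lemma separated_env_map_isomorphism:
  assumes separated
  shows "incl_isomorphism env_map (envelope A F) (final_segments (chain_product k n))"
proof -
  have "inj_on env_map (envelope A F)"
    using env_map_le_iff by (auto intro!: inj_onI)
  moreover have "env_map ` envelope A F = final_segments (chain_product k n)"
    using env_map_embedding separated_env_map_surj[OF assms] by (auto simp: incl_embedding_def)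
  ultimately show ?thesis
    using env_map_le_iff by (simp add: incl_isomorphism_def bij_betw_def)
qed

end

theorem theorem2:
  fixes A :: "'a::order set"
    and k :: nat
    and n :: "nat \<Rightarrow> nat"
    and X :: "nat \<Rightarrow> nat \<Rightarrow> 'a set"
    and F :: "'a list set"
  assumes "k \<ge> 1"
    and "\<And>i j. i < k \<Longrightarrow> j < n i \<Longrightarrow> X i j \<subseteq> A"
    and "\<And>i j. i < k \<Longrightarrow> j < n i \<Longrightarrow> X i j \<noteq> {}"
    and "F = (\<Union>i<k. word_up A (box_words (n i) (X i)))"
  shows "(\<exists>f. incl_embedding f (envelope A F) (final_segments (chain_product k n)) \<and>
              inter_closed (chain_product k n) (f ` envelope A F)) \<and>
         ((\<forall>i<k. \<forall>j<k. i \<noteq> j \<longrightarrow>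
             (\<forall>u\<in>box_words (n i) (X i). \<forall>v\<in>box_words (n j) (X j).
                word_down A u \<inter> word_down A v = {[]})) \<longrightarrow>
          (\<exists>g. incl_isomorphism g (envelope A F) (final_segments (chain_product k n))))"
proof -
  interpret B: box_union A k n X
    using assms(2,3) by unfold_locales
  have F: "F = B.F" by (simp add: assms(4) B.F_def)
  show ?thesis
    unfolding F using B.env_map_embedding B.env_map_inter_closed
      B.separated_env_map_isomorphism[unfolded B.separated_def] by blast
qed

end
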